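(* There exists a pacing function $\mu:\Theta\to\mathbb{R}_{\ge0}$ such that $\mu(w,B)\in\arg\min_{t\ge0}q^\mu(w,B,t)$ for $G$-almost every $(w,B)\in\Theta$.
   Context: Setting. Fix integers $n\ge 2$ and $d\ge 2$, and constants $U>0$, $B_{\min}>0$. Buyer types are $\theta=(w,B)\in\Theta:=(0,U)^d\times(B_{\min},U)$; $\Theta_w:=(0,U)^d$. Item types are $\alpha\in A\subset\mathbb{R}^d_{+}$ (strictly positive orthant); all sets carry the Lebesgue $\sigma$-algebra. $F$ is a probability distribution on $A$ with a density and $G$ a probability distribution on $\Theta$ with a density. Buyer $(w,B)$ values item $\alpha$ at $w^T\alpha$; $\omega>0$ is a constant with $w^T\alpha\le\omega$ for all $w\in\Theta_w,\alpha\in A$. Reserve prices: measurable $r:A\to(0,\infty)$. A pacing function is a measurable $\mu:\Theta\to\mathbb{R}_{\ge0}$. For $\alpha\in A$, $\lambda^\mu_\alpha$ is the distribution of $w^T\alpha/(1+\mu(w,B))$ when $(w,B)\sim G$, and $H^\mu_\alpha$ the distribution of the maximum of $n-1$ i.i.d. draws from $\lambda^\mu_\alpha$; $H^\mu_\alpha(x):=\lambda^\mu_\alpha((-\infty,x])^{n-1}$. The dual function is $q^\mu(w,B,t):=(1+t)\,\mathbb{E}_{\alpha\sim F}\Big[\mathbf 1\Big\{\frac{w^T\alpha}{1+t}\ge r(\alpha)\Big\}\int_{r(\alpha)}^{\frac{w^T\alpha}{1+t}}H^\mu_\alpha(s)\,ds\Big]+tB$, for $t\ge0$. *)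

theory Defs
  imports "HOL-Probability.Probability"
begin

definition Theta_w :: "real \<Rightarrow> (real^'d) set" where
  "Theta_w U = {w. \<forall>i. 0 < w$i \<and> w$i < U}"

definition Theta :: "real \<Rightarrow> real \<Rightarrow> ((real^'d) \<times> real) set" where
  "Theta U Bmin = Theta_w U \<times> {Bmin<..<U}"

definition lam :: "((real^'d) \<times> real) measure \<Rightarrow> ((real^'d) \<times> real \<Rightarrow> real)
    \<Rightarrow> real^'d \<Rightarrow> real measure" where
  "lam G \<mu> \<alpha> = distr G borel (\<lambda>(w,B). (w \<bullet> \<alpha>) / (1 + \<mu> (w,B)))"

definition Hcdf :: "nat \<Rightarrow> ((real^'d) \<times> real) measure \<Rightarrow> ((real^'d) \<times> real \<Rightarrow> real)
    \<Rightarrow> real^'d \<Rightarrow> real \<Rightarrow> real" where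
  "Hcdf n G \<mu> \<alpha> x = (measure (lam G \<mu> \<alpha>) {..x}) ^ (n - 1)"

definition qdual :: "nat \<Rightarrow> ((real^'d) \<times> real) measure \<Rightarrow> (real^'d) measure
    \<Rightarrow> (real^'d \<Rightarrow> real) \<Rightarrow> ((real^'d) \<times> real \<Rightarrow> real)
    \<Rightarrow> real^'d \<Rightarrow> real \<Rightarrow> real \<Rightarrow> real" where
  "qdual n G F r \<mu> w B t =
     (1 + t) * (\<integral>\<alpha>. (if (w \<bullet> \<alpha>) / (1 + t) \<ge> r \<alpha>
                      then (LBINT s:{r \<alpha> .. (w \<bullet> \<alpha>) / (1 + t)}. Hcdf n G \<mu> \<alpha> s)
                      else 0) \<partial>F)
     + t * B"

end

theory Submission
  imports Defs "HOL-Complex_Analysis.Great_Picard"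
begin

text \<open>
  Up to the term \<open>t * B\<close>, the dual function is \<open>h (w, t) = qdual w 0 t\<close>, which is Lipschitz in \<open>(w, t)\<close>
  with a constant independent of \<open>\<mu>\<close>. Hence it is enough to find a fixed point of the
  map that sends \<open>h\<close> to the least minimiser \<open>\<mu>\<close> of \<open>t \<mapsto> h (w, t) + t * B\<close> on a compact interval and
  then to the dual function of \<open>\<mu>\<close>. This map is continuous for pointwise convergence of
  equi-Lipschitz functions: the minimiser is unique for almost every \<open>(w, B)\<close>, hence the minimisers
  converge almost everywhere, the value distributions converge at all but countably many points,
  and the integrals converge by dominated convergence. The fixed point comes from Kuhn's
  combinatorial lemma: it gives a Brouwer theorem for the Hilbert cube, which is applied to the values
  of \<open>h\<close> at a dense sequence, interpolated from finitely many of them at a time.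
\<close>


section \<open>From Kuhn's lemma to a fixed point theorem for equi-Lipschitz functions\<close>

section \<open>Fixed points\<close>

text \<open>Kuhn's lemma on a grid: label each grid point, coordinate by coordinate, by whether
  \<open>F\<close> pushes it up or down. A cell in which both labels occur for every coordinate
  \<open>i < n\<close> supplies \<open>r\<close> and \<open>s\<close>, both within one mesh width of
  \<open>q\<close>.\<close>

lemma cube_approx_fixpoint:
  fixes F :: "(nat \<Rightarrow> real) \<Rightarrow> nat \<Rightarrow> real" and M :: real and n :: nat
  assumes M: "0 < M"
    and maps: "\<And>x i. (\<forall>j. x j \<in> {0..M}) \<Longrightarrow> F x i \<in> {0..M}"
  shows "\<exists>q. (\<forall>j. q j \<in> {0..M}) \<and> (\<forall>i<n. \<exists>r s. 
           (\<forall>j. r j \<in> {0..M} \<and> \<bar>r j - q j\<bar> \<le> M / Suc n) \<and>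
           (\<forall>j. s j \<in> {0..M} \<and> \<bar>s j - q j\<bar> \<le> M / Suc n) \<and>
           r i \<le> F r i \<and> F s i \<le> s i)"
proof -
  \<comment> \<open>The same \<open>n\<close> is both the number of active coordinates and, up to
    one, the number of grid steps per side. Letting \<open>n\<close> grow therefore exhausts the
    coordinates and refines the mesh at once; the inactive tail is frozen at 0.\<close>
  define emb :: "(nat \<Rightarrow> nat) \<Rightarrow> nat \<Rightarrow> real"
    where "emb v j = (if j < n then M * (real (v j) / Suc n) else 0)" for v j
  \<comment> \<open>Kuhn's lemma prescribes the labels on the two opposite faces. They remain
    truthful there, since \<open>F\<close> maps into the cube: at 0 it cannot push down, at
    \<open>M\<close> it cannot push up.\<close>
  define label :: "(nat \<Rightarrow> nat) \<Rightarrow> nat \<Rightarrow> nat"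
    where "label v i = (if v i = 0 then 0 else if v i = Suc n then 1
             else if emb v i \<le> F (emb v) i then 0 else 1)" for v i
  have emb_range: "emb v j \<in> {0..M}" if "\<forall>i<n. v i \<le> Suc n" for v j
  proof (cases "j < n")
    case True
    then have "real (v j) / Suc n \<le> 1"
      using that[rule_format, OF True] by (simp add: divide_le_eq)
    then have "M * (real (v j) / Suc n) \<le> M * 1"
      using M by (intro mult_left_mono) auto
    then show ?thesis
      using M True by (auto simp: emb_def)
  qed (use M in \<open>auto simp: emb_def\<close>)
  have label0: "emb v i \<le> F (emb v) i" if "\<forall>i<n. v i \<le> Suc n" "i < n" "label v i = 0" for v i
  proof (cases "v i = 0")
    case True
    then show ?thesis
      using maps[of "emb v" i] emb_range[OF that(1)] by (simp add: emb_def)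
  next
    case False
    then show ?thesis
      using that by (auto simp: label_def split: if_splits)
  qed
  have label1: "F (emb v) i \<le> emb v i" if "\<forall>i<n. v i \<le> Suc n" "i < n" "label v i = 1" for v i
  proof (cases "v i = Suc n")
    case True
    then have "emb v i = M"
      using that(2) by (simp add: emb_def del: of_nat_Suc)
    then show ?thesis
      using maps[of "emb v" i] emb_range[OF that(1)] by simp
  next
    case False
    then show ?thesis
      using that by (auto simp: label_def split: if_splits)
  qed
  have close: "\<bar>emb v j - emb u j\<bar> \<le> M / Suc n" if "\<forall>j<n. u j \<le> v j \<and> v j \<le> u j + 1" for u v j
  proof (cases "j < n")
    case True
    then have "\<bar>real (v j) - real (u j)\<bar> \<le> 1"
      using that by force
    moreover have "emb v j - emb u j = M / Suc n * (real (v j) - real (u j))"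
      using True by (simp add: emb_def right_diff_distrib diff_divide_distrib)
    ultimately show ?thesis
      using M mult_left_mono[of "\<bar>real (v j) - real (u j)\<bar>" 1 "M / Suc n"] by (simp add: abs_mult)
  qed (use M in \<open>auto simp: emb_def\<close>)
  obtain q where q: "\<forall>i<n. q i < Suc n"
    and rs: "\<forall>i<n. \<exists>r s. (\<forall>j<n. q j \<le> r j \<and> r j \<le> q j + 1) \<and>
               (\<forall>j<n. q j \<le> s j \<and> s j \<le> q j + 1) \<and> label r i \<noteq> label s i"
    by (rule kuhn_lemma[of "Suc n" n label]) (auto simp: label_def)
  have "\<exists>r s. (\<forall>j. r j \<in> {0..M} \<and> \<bar>r j - emb q j\<bar> \<le> M / Suc n) \<and>
           (\<forall>j. s j \<in> {0..M} \<and> \<bar>s j - emb q j\<bar> \<le> M / Suc n) \<and>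
           r i \<le> F r i \<and> F s i \<le> s i" if "i < n" for i
  proof -
    obtain r s where r: "\<forall>j<n. q j \<le> r j \<and> r j \<le> q j + 1"
      and s: "\<forall>j<n. q j \<le> s j \<and> s j \<le> q j + 1" and ne: "label r i \<noteq> label s i"
      using rs \<open>i < n\<close> by blast
    have r': "\<forall>j<n. r j \<le> Suc n" and s': "\<forall>j<n. s j \<le> Suc n"
      using q r s by (metis Suc_eq_plus1 Suc_leI le_trans not_less_eq_eq add.commute)+
    have "label r i = 0 \<and> label s i = 1 \<or> label s i = 0 \<and> label r i = 1"
      using ne by (auto simp: label_def split: if_splits)
    then show ?thesis
    proof
      assume "label r i = 0 \<and> label s i = 1"
      then show ?thesis
        using label0[OF r' \<open>i < n\<close>] label1[OF s' \<open>i < n\<close>] emb_range[OF r'] emb_range[OF s'] close[OF r] close[OF s]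
        by (intro exI[of _ "emb r"] exI[of _ "emb s"]) simp
    next
      assume "label s i = 0 \<and> label r i = 1"
      then show ?thesis
        using label0[OF s' \<open>i < n\<close>] label1[OF r' \<open>i < n\<close>] emb_range[OF r'] emb_range[OF s'] close[OF r] close[OF s]
        by (intro exI[of _ "emb s"] exI[of _ "emb r"]) simp
    qed
  qed
  moreover have "\<forall>j. emb q j \<in> {0..M}"
    using q by (intro allI emb_range) (simp add: less_imp_le)
  ultimately show ?thesis by blast
qed

text \<open>A diagonal subsequence of the approximate solutions converges in every coordinate. The
  points \<open>r\<close> and \<open>s\<close> share that limit because the mesh vanishes, so their
  opposite inequalities squeeze \<open>F y i\<close> onto \<open>y i\<close>.\<close>

lemma hilbert_cube_fixpoint:
  fixes F :: "(nat \<Rightarrow> real) \<Rightarrow> nat \<Rightarrow> real" and M :: real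
  assumes M: "0 < M"
    and maps: "\<And>x i. (\<forall>j. x j \<in> {0..M}) \<Longrightarrow> F x i \<in> {0..M}"
    and cont: "\<And>X x i. (\<forall>k j. X k j \<in> {0..M}) \<Longrightarrow> (\<forall>j. (\<lambda>k. X k j) \<longlonglongrightarrow> x j)
                 \<Longrightarrow> (\<lambda>k::nat. F (X k) i) \<longlonglongrightarrow> F x i"
  obtains x where "\<forall>j. x j \<in> {0..M}" "F x = x"
proof -
  obtain Q where Q: "\<And>n j. Q n j \<in> {0..M}"
    and near: "\<And>n i. i < n \<Longrightarrow> \<exists>r s. 
           (\<forall>j. r j \<in> {0..M} \<and> \<bar>r j - Q n j\<bar> \<le> M / Suc n) \<and>
           (\<forall>j. s j \<in> {0..M} \<and> \<bar>s j - Q n j\<bar> \<le> M / Suc n) \<and>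
           r i \<le> F r i \<and> F s i \<le> s i"
    using cube_approx_fixpoint[where F = F, OF M maps] by metis
  obtain k :: "nat \<Rightarrow> nat" where k: "strict_mono k" "\<And>j. \<exists>l. (\<lambda>n. Q (k n) j) \<longlonglongrightarrow> l"
  proof (rule function_convergent_subsequence[of UNIV Q M])
    show "norm (Q n j) \<le> M" for n j using Q[of n j] by auto
  qed auto
  then obtain y where y: "\<And>j. (\<lambda>n. Q (k n) j) \<longlonglongrightarrow> y j" by metis
  have y_range: "y j \<in> {0..M}" for j
    by (rule closed_sequentially[OF closed_atLeastAtMost _ y]) (rule Q)
  have mesh: "(\<lambda>n. M / Suc (k n)) \<longlonglongrightarrow> 0"
    using LIMSEQ_subseq_LIMSEQ[OF LIMSEQ_Suc[OF lim_const_over_n[of M]] k(1)] by (simp add: o_def)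
  have conv: "(\<lambda>n. R n j) \<longlonglongrightarrow> y j" if "\<And>n. \<bar>R n j - Q (k n) j\<bar> \<le> M / Suc (k n)" for R j
  proof -
    have "(\<lambda>n. R n j - Q (k n) j) \<longlonglongrightarrow> 0"
      by (rule Lim_null_comparison[OF _ mesh]) (use that in auto)
    from tendsto_add[OF this y[of j]] show ?thesis by simp
  qed
  have "F y i = y i" for i
  proof -
    \<comment> \<open>The two inequalities are guarded by \<open>i < n\<close> so that sequences
      \<open>R\<close> and \<open>S\<close> can be chosen for all \<open>n\<close>; for the finitely
      many others \<open>Q n\<close> itself serves as witness. Since \<open>k n \<ge> n\<close>, the
      guard holds eventually along the subsequence.\<close>
    have "\<exists>r s. (\<forall>j. r j \<in> {0..M} \<and> \<bar>r j - Q n j\<bar> \<le> M / Suc n) \<and>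
           (\<forall>j. s j \<in> {0..M} \<and> \<bar>s j - Q n j\<bar> \<le> M / Suc n) \<and>
           (i < n \<longrightarrow> r i \<le> F r i \<and> F s i \<le> s i)" for n
    proof (cases "i < n")
      case True
      then show ?thesis using near[OF True] by blast
    next
      case False
      then show ?thesis using Q M by (intro exI[of _ "Q n"]) auto
    qed
    then obtain R S where R: "\<And>n j. R n j \<in> {0..M}" "\<And>n j. \<bar>R n j - Q n j\<bar> \<le> M / Suc n"
      and S: "\<And>n j. S n j \<in> {0..M}" "\<And>n j. \<bar>S n j - Q n j\<bar> \<le> M / Suc n"
      and RS: "\<And>n. i < n \<Longrightarrow> R n i \<le> F (R n) i \<and> F (S n) i \<le> S n i"
      by metis
    have Ry: "(\<lambda>n. R (k n) j) \<longlonglongrightarrow> y j" and Sy: "(\<lambda>n. S (k n) j) \<longlonglongrightarrow> y j" for j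
      by (rule conv, rule R(2), rule conv, rule S(2))
    have FR: "(\<lambda>n. F (R (k n)) i) \<longlonglongrightarrow> F y i" and FS: "(\<lambda>n. F (S (k n)) i) \<longlonglongrightarrow> F y i"
      using R(1) S(1) Ry Sy by (auto intro: cont)
    have i_less: "i < k n" if "n \<ge> Suc i" for n
      using seq_suble[OF k(1), of n] that by linarith
    have "y i \<le> F y i"
      by (rule LIMSEQ_le[OF Ry FR]) (use RS i_less in blast)
    moreover have "F y i \<le> y i"
      by (rule LIMSEQ_le[OF FS Sy]) (use RS i_less in blast)
    ultimately show ?thesis by simp
  qed
  then show thesis using that y_range by blast
qed

text \<open>Discretise by the values at a dense sequence. McShane extension from finitely many of
  these values gives an admissible argument for \<open>\<Psi>\<close> that depends continuously on
  them, so the Hilbert cube theorem applies for each \<open>N\<close>; equi-Lipschitz compactness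
  then lets \<open>N\<close> tend to infinity.\<close>

lemma lipschitz_fixpoint:
  fixes \<Psi> :: "('a::{metric_space,second_countable_topology} \<Rightarrow> real) \<Rightarrow> 'a \<Rightarrow> real"
    and L M :: real
  assumes M: "0 < M" and L: "0 \<le> L"
    and lip: "\<And>h. L-lipschitz_on UNIV h \<Longrightarrow> L-lipschitz_on UNIV (\<Psi> h)"
    and range: "\<And>h p. L-lipschitz_on UNIV h \<Longrightarrow> \<Psi> h p \<in> {0..M}"
    and cont: "\<And>H h p. (\<And>k::nat. L-lipschitz_on UNIV (H k)) \<Longrightarrow> (\<And>p. (\<lambda>k. H k p) \<longlonglongrightarrow> h p)
                 \<Longrightarrow> (\<lambda>k. \<Psi> (H k) p) \<longlonglongrightarrow> \<Psi> h p"
  obtains h where "L-lipschitz_on UNIV h" "\<Psi> h = h"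
proof -
  obtain D :: "'a set" where D: "countable D"
    "\<And>X. open X \<Longrightarrow> X \<noteq> {} \<Longrightarrow> \<exists>d\<in>D. d \<in> X"
    using countable_dense_setE by blast
  define q where "q = from_nat_into D"
  have "D \<noteq> {}" using D(2)[of UNIV] by auto
  have dense: "\<exists>i. dist p (q i) < e" if "e > 0" for p e
  proof -
    have "ball p e \<noteq> {}" using that by simp
    then obtain d where "d \<in> D" "d \<in> ball p e" using D(2)[OF open_ball] by blast
    then show ?thesis
      using from_nat_into_surj[OF D(1)] by (force simp: q_def)
  qed
  \<comment> \<open>the McShane extension of the data \<open>x i\<close> prescribed at \<open>q 0, \<dots>, q N\<close>\<close>
  define mcs where "mcs N x p = Min ((\<lambda>i. x i + L * dist p (q i)) ` {..N})"
    for N :: nat and x :: "nat \<Rightarrow> real" and p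
  have mcs_le: "mcs N x p \<le> x i + L * dist p (q i)" if "i \<le> N" for N x p i
    unfolding mcs_def using that by (intro Min_le) auto
  have mcs_att: "\<exists>i\<le>N. mcs N x p = x i + L * dist p (q i)" for N x p
    using Min_in[of "(\<lambda>i. x i + L * dist p (q i)) ` {..N}"] unfolding mcs_def by fastforce
  have mcs_lip: "L-lipschitz_on UNIV (mcs N x)" for N x
  proof -
    have *: "mcs N x p \<le> mcs N x p' + L * dist p p'" for p p'
    proof -
      obtain i where i: "i \<le> N" "mcs N x p' = x i + L * dist p' (q i)"
        using mcs_att by blast
      have "mcs N x p \<le> x i + L * dist p (q i)" by (rule mcs_le[OF i(1)])
      also have "\<dots> \<le> x i + L * (dist p p' + dist p' (q i))"
        using L by (intro add_left_mono mult_left_mono dist_triangle) auto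
      finally show ?thesis using i(2) by (simp add: algebra_simps)
    qed
    show ?thesis
    proof (rule lipschitz_onI)
      show "dist (mcs N x p) (mcs N x p') \<le> L * dist p p'" for p p'
        using *[of p p'] *[of p' p] by (simp add: dist_real_def dist_commute abs_le_iff)
    qed (rule L)
  qed
  have mcs_cont: "(\<lambda>k. mcs N (X k) p) \<longlonglongrightarrow> mcs N x p"
    if "\<forall>j. (\<lambda>k. X k j) \<longlonglongrightarrow> x j" for N X x p
  proof (induction N)
    case 0
    then show ?case using that by (auto simp: mcs_def intro!: tendsto_intros)
  next
    case (Suc N)
    have "mcs (Suc N) z p = min (z (Suc N) + L * dist p (q (Suc N))) (mcs N z p)" for z
      by (simp add: mcs_def atMost_Suc)
    then show ?case using that Suc by (auto intro!: tendsto_intros)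
  qed
  \<comment> \<open>Only \<open>x 0\<close> up to \<open>x N\<close> enter \<open>mcs N x\<close>,
    but the fixed point equation records \<open>\<Psi>\<close> at the whole dense sequence. The data
    for different \<open>N\<close> can thus be compared coordinate by coordinate.\<close>
  have ex: "\<exists>x. (\<forall>j. x j \<in> {0..M}) \<and> (\<lambda>i. \<Psi> (mcs N x) (q i)) = x" for N
  proof -
    obtain x where "\<forall>j. x j \<in> {0..M}" "(\<lambda>i. \<Psi> (mcs N x) (q i)) = x"
    proof (rule hilbert_cube_fixpoint[OF M, of "\<lambda>x i. \<Psi> (mcs N x) (q i)"])
      show "\<Psi> (mcs N x) (q i) \<in> {0..M}" for x i
        by (rule range[OF mcs_lip])
      show "(\<lambda>k. \<Psi> (mcs N (X k)) (q i)) \<longlonglongrightarrow> \<Psi> (mcs N x) (q i)"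
        if "\<forall>j. (\<lambda>k. X k j) \<longlonglongrightarrow> x j" for X x i
        by (rule cont[OF mcs_lip mcs_cont[OF that]])
    qed auto
    then show ?thesis by blast
  qed
  then obtain x where x_range: "\<And>N j. x N j \<in> {0..M}"
    and x_fix: "\<And>N i. \<Psi> (mcs N (x N)) (q i) = x N i"
    by metis
  \<comment> \<open>Arbitrary data need not be interpolated by \<open>mcs\<close>. At a fixed point
    the data are values of an \<open>L\<close>-Lipschitz function, and this compatibility makes the
    extension agree with them.\<close>
  have x_lip: "\<bar>x N i - x N j\<bar> \<le> L * dist (q i) (q j)" for N i j
    using lipschitz_onD[OF lip[OF mcs_lip[of N "x N"]], of "q i" "q j"] 
    by (simp add: x_fix dist_real_def)
  have mcs_q: "mcs N (x N) (q j) = x N j" if "j \<le> N" for N j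
  proof (rule antisym)
    show "mcs N (x N) (q j) \<le> x N j" using mcs_le[OF that, of "x N" "q j"] by simp
    obtain i where "mcs N (x N) (q j) = x N i + L * dist (q j) (q i)"
      using mcs_att by blast
    then show "x N j \<le> mcs N (x N) (q j)" using x_lip[of N j i] by simp
  qed
  obtain k :: "nat \<Rightarrow> nat" where k: "strict_mono k" "\<And>j. \<exists>l. (\<lambda>n. x (k n) j) \<longlonglongrightarrow> l"
  proof (rule function_convergent_subsequence[of UNIV x M])
    show "norm (x n j) \<le> M" for n j using x_range[of n j] by auto
  qed auto
  then obtain y where y: "\<And>j. (\<lambda>n. x (k n) j) \<longlonglongrightarrow> y j" by metis
  define H where "H n = mcs (k n) (x (k n))" for n
  have H_lip: "L-lipschitz_on UNIV (H n)" for n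
    unfolding H_def by (rule mcs_lip)
  have Hq: "(\<lambda>n. H n (q j)) \<longlonglongrightarrow> y j" for j
  proof (rule Lim_transform_eventually[OF y])
    show "eventually (\<lambda>n. x (k n) j = H n (q j)) sequentially"
      using eventually_ge_at_top[of j]
    proof eventually_elim
      case (elim n)
      then have "j \<le> k n" using seq_suble[OF k(1), of n] by linarith
      then show ?case by (simp add: H_def mcs_q)
    qed
  qed
  have "convergent (\<lambda>n. H n p)" for p
  proof (rule Cauchy_convergent, rule metric_CauchyI)
    fix e :: real assume "e > 0"
    \<comment> \<open>Two errors of size \<open>e / 4\<close> from moving to a dense point, plus
      \<open>e / 2\<close> from the Cauchy property there, make \<open>e\<close>. The denominator
      uses \<open>L + 1\<close> to cover \<open>L = 0\<close>.\<close>
    define d where "d = e / (4 * (L + 1))"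
    have d: "d > 0" "L * d < e / 4"
      using \<open>e > 0\<close> L by (auto simp: d_def field_simps)
    obtain j where j: "dist p (q j) < d" using dense[OF d(1)] by blast
    have near: "dist (H n p) (H n (q j)) < e / 4" for n
    proof -
      have "dist (H n p) (H n (q j)) \<le> L * dist p (q j)"
        using lipschitz_onD[OF H_lip] by blast
      also have "\<dots> \<le> L * d" using j L by (intro mult_left_mono) auto
      finally show ?thesis using d(2) by simp
    qed
    have "Cauchy (\<lambda>n. H n (q j))" using Hq LIMSEQ_imp_Cauchy by blast
    then obtain N0 where N0: "\<forall>m\<ge>N0. \<forall>n\<ge>N0. dist (H m (q j)) (H n (q j)) < e / 2"
      using \<open>e > 0\<close> by (metis metric_CauchyD half_gt_zero)
    have "dist (H m p) (H n p) < e" if "m \<ge> N0" "n \<ge> N0" for m n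
    proof -
      have "dist (H m (q j)) (H n (q j)) < e / 2" using N0 that by blast
      then show ?thesis
        using near[of m] near[of n] unfolding dist_real_def by linarith
    qed
    then show "\<exists>N0. \<forall>m\<ge>N0. \<forall>n\<ge>N0. dist (H m p) (H n p) < e" by blast
  qed
  then obtain h where h: "\<And>p. (\<lambda>n. H n p) \<longlonglongrightarrow> h p"
    unfolding convergent_def by metis
  have h_lip: "L-lipschitz_on UNIV h"
  proof (rule lipschitz_onI)
    show "dist (h p) (h p') \<le> L * dist p p'" for p p'
      by (rule LIMSEQ_le_const2[OF tendsto_dist[OF h h]])
         (use lipschitz_onD[OF H_lip] in blast)
  qed (rule L)
  have "\<Psi> h (q j) = h (q j)" for j
  proof -
    have "(\<lambda>n. \<Psi> (H n) (q j)) \<longlonglongrightarrow> \<Psi> h (q j)"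
      by (rule cont[OF H_lip h])
    then have "(\<lambda>n. x (k n) j) \<longlonglongrightarrow> \<Psi> h (q j)"
      by (simp add: H_def x_fix)
    with y have "\<Psi> h (q j) = y j" using LIMSEQ_unique by blast
    moreover have "h (q j) = y j" using h Hq LIMSEQ_unique by blast
    ultimately show ?thesis by simp
  qed
  moreover have "closure (range q) = UNIV"
    using dense by (auto simp: closure_approachable dist_commute) 
  moreover have "continuous_on UNIV (\<Psi> h)" "continuous_on UNIV h"
    using lip[OF h_lip] h_lip lipschitz_on_continuous_on by blast+
  ultimately have "\<Psi> h p - h p = 0" for p
    by (intro continuous_constant_on_closure[of "range q" "\<lambda>p. \<Psi> h p - h p" 0 p])
       (auto intro!: continuous_intros)
  then show thesis using that[OF h_lip] by auto
qed


section \<open>Minimisers of the dual: measurable selection, generic uniqueness and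
  stability\<close>

section \<open>Best responses\<close>

text \<open>The real components of the two pairs differ in meaning: in \<open>\<theta>\<close> it is
  the budget, in the argument of \<open>h\<close> it is the multiplier \<open>t\<close>. The budget
  enters only through the linear term, so \<open>h\<close> itself does not depend on it.\<close>

definition argmins :: "real \<Rightarrow> ('a \<times> real \<Rightarrow> real) \<Rightarrow> 'a \<times> real \<Rightarrow> real set" where
  "argmins T h \<theta> = {t \<in> {0..T}. \<forall>s\<in>{0..T}. h (fst \<theta>, t) + t * snd \<theta> \<le> h (fst \<theta>, s) + s * snd \<theta>}"

definition least_argmin :: "real \<Rightarrow> ('a \<times> real \<Rightarrow> real) \<Rightarrow> 'a \<times> real \<Rightarrow> real" where
  "least_argmin T h \<theta> = Inf (argmins T h \<theta>)"

text \<open>The graph of the minimiser correspondence is closed, and projecting a closed set along a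
  compact interval keeps it closed. This is the source of every measurability claim about
  minimisers.\<close>

lemma closed_argmins_hit:
  fixes h :: "'a::euclidean_space \<times> real \<Rightarrow> real"
  assumes h: "continuous_on UNIV h"
  shows "closed {\<theta>. \<exists>t. t \<in> {a..b} \<and> t \<in> argmins T h \<theta>}"
proof -
  have hc: "continuous_on S (\<lambda>x. h (f x))" if "continuous_on S f" for S and f :: "'c::topological_space \<Rightarrow> 'a \<times> real"
    by (rule continuous_on_compose2[OF h that]) auto
  have "closed ({0..T} \<times> UNIV \<inter> (\<Inter>s\<in>{0..T}. {x. h (fst (snd x), fst x) + fst x * snd (snd x)
            \<le> h (fst (snd x), s) + s * snd (snd x)}) :: (real \<times> 'a \<times> real) set)"
    by (intro closed_Int closed_Times closed_atLeastAtMost closed_UNIV closed_INT ballI closed_Collect_le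
        continuous_intros hc)
  also have "\<dots> = {(t, \<theta>). t \<in> argmins T h \<theta>}"
    by (auto simp: argmins_def)
  finally have "closed {\<theta>. \<exists>t. t \<in> {a..b} \<and> (t, \<theta>) \<in> {(t, \<theta>). t \<in> argmins T h \<theta>}}"
    by (intro closed_compact_projection compact_Icc)
  then show ?thesis by simp
qed

lemma least_argmin_in:
  fixes h :: "'a::euclidean_space \<times> real \<Rightarrow> real"
  assumes h: "continuous_on UNIV h" and T: "0 \<le> T"
  shows "least_argmin T h \<theta> \<in> argmins T h \<theta>"
proof -
  have hc: "continuous_on S (\<lambda>x. h (f x))" if "continuous_on S f" for S and f :: "'c::topological_space \<Rightarrow> 'a \<times> real"
    by (rule continuous_on_compose2[OF h that]) auto
  have "closed ({0..T} \<inter> (\<Inter>s\<in>{0..T}. {t. h (fst \<theta>, t) + t * snd \<theta> \<le> h (fst \<theta>, s) + s * snd \<theta>}))"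
    by (intro closed_Int closed_atLeastAtMost closed_INT ballI closed_Collect_le continuous_intros hc)
  also have "\<dots> = argmins T h \<theta>" by (auto simp: argmins_def)
  finally have "closed (argmins T h \<theta>)" .
  moreover have "argmins T h \<theta> \<noteq> {}"
  proof -
    have "\<exists>x\<in>{0..T}. \<forall>y\<in>{0..T}. h (fst \<theta>, x) + x * snd \<theta> \<le> h (fst \<theta>, y) + y * snd \<theta>"
      using T by (intro continuous_attains_inf continuous_intros hc) auto
    then show ?thesis by (auto simp: argmins_def)
  qed
  moreover have "bdd_below (argmins T h \<theta>)"
    by (rule bdd_belowI[of _ 0]) (auto simp: argmins_def)
  ultimately show ?thesis
    unfolding least_argmin_def by (intro closed_contains_Inf)
qed

lemma least_argmin_le:
  assumes "t \<in> argmins T h \<theta>"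
  shows "least_argmin T h \<theta> \<le> t"
  unfolding least_argmin_def
  by (intro cInf_lower assms bdd_belowI[of _ 0]) (auto simp: argmins_def)

text \<open>The least minimiser is at most \<open>c\<close> exactly when some minimiser lies in
  \<open>{0..c}\<close>, so sublevel sets are closed. This is why the least one is selected.\<close>

lemma least_argmin_measurable:
  fixes h :: "'a::euclidean_space \<times> real \<Rightarrow> real"
  assumes h: "continuous_on UNIV h" and T: "0 \<le> T"
  shows "least_argmin T h \<in> borel_measurable borel"
proof (subst borel_measurable_iff_le, rule allI)
  fix c
  have "{\<theta>. least_argmin T h \<theta> \<le> c} = {\<theta>. \<exists>t. t \<in> {0..c} \<and> t \<in> argmins T h \<theta>}"
    (is "?L = ?R")
  proof (intro equalityI subsetI)
    fix \<theta> assume "\<theta> \<in> ?L"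
    then show "\<theta> \<in> ?R"
      using least_argmin_in[OF h T, of \<theta>] by (intro CollectI exI[of _ "least_argmin T h \<theta>"]) (auto simp: argmins_def)
  next
    fix \<theta> assume "\<theta> \<in> ?R"
    then show "\<theta> \<in> ?L" using least_argmin_le[of _ T h \<theta>] by fastforce
  qed
  then show "{\<theta> \<in> space borel. least_argmin T h \<theta> \<le> c} \<in> sets borel"
    using closed_argmins_hit[OF h, of 0 c T] by simp
qed

text \<open>For fixed \<open>w\<close> the minimisers of \<open>t \<mapsto> h (w, t) + t * B\<close> move left as \<open>B\<close> grows, so two
  minimisers can lie on either side of a given rational gap \<open>(a, b)\<close> for at most one \<open>B\<close>.\<close>

lemma AE_argmins_unique:
  fixes h :: "'a::euclidean_space \<times> real \<Rightarrow> real"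
  assumes h: "continuous_on UNIV h"
  shows "AE \<theta> in lborel. \<forall>s\<in>argmins T h \<theta>. \<forall>t\<in>argmins T h \<theta>. s = t"
proof -
  define N where "N a b = {\<theta>. \<exists>t. t \<in> {0..a} \<and> t \<in> argmins T h \<theta>} \<inter> {\<theta>. \<exists>t. t \<in> {b..T} \<and> t \<in> argmins T h \<theta>}"
    for a b
  have N_sets: "N a b \<in> sets borel" for a b
    unfolding N_def using closed_argmins_hit[OF h] by auto
  have fibre: "B = B'" if "(w, B) \<in> N a b" "(w, B') \<in> N a b" "a < b" for w B B' a b
  proof -
    have le: False if "(w, B) \<in> N a b" "(w, B') \<in> N a b" "B < B'" for B B'
    proof -
      obtain s t where st: "s \<in> {0..a}" "s \<in> argmins T h (w, B)" "t \<in> {b..T}" "t \<in> argmins T h (w, B')"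
        using \<open>(w, B) \<in> N a b\<close> \<open>(w, B') \<in> N a b\<close> unfolding N_def by blast
      then have "h (w, s) + s * B \<le> h (w, t) + t * B" "h (w, t) + t * B' \<le> h (w, s) + s * B'"
        by (auto simp: argmins_def)
      then have "(t - s) * (B' - B) \<le> 0" by (simp add: algebra_simps)
      moreover have "(t - s) * (B' - B) > 0"
        using st \<open>a < b\<close> \<open>B < B'\<close> by (intro mult_pos_pos) auto
      ultimately show False by simp
    qed
    show ?thesis using le[of B B'] le[of B' B] that by (cases B B' rule: linorder_cases) auto
  qed
  have null: "N a b \<in> null_sets (lborel :: ('a \<times> real) measure)" if "a < b" for a b
  proof -
    have Ns: "N a b \<in> sets (lborel \<Otimes>\<^sub>M lborel)"
      unfolding lborel_prod using N_sets[of a b] by simp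
    \<comment> \<open>By \<open>fibre\<close> each section over \<open>w\<close> contains at most
      one budget, hence is null; Fubini makes \<open>N a b\<close> null.\<close>
    have "emeasure lborel (Pair w -` N a b) = 0" for w
    proof -
      have "\<exists>B. Pair w -` N a b \<subseteq> {B}"
      proof (cases "Pair w -` N a b = {}")
        case False
        then obtain B where "(w, B) \<in> N a b" by auto
        then have "Pair w -` N a b \<subseteq> {B}" using fibre[OF _ _ that] by auto
        then show ?thesis ..
      qed auto
      then obtain B where "Pair w -` N a b \<subseteq> {B}" by blast
      then show ?thesis using emeasure_mono[of "Pair w -` N a b" "{B}" lborel] by simp
    qed
    then have "emeasure (lborel \<Otimes>\<^sub>M lborel) (N a b) = 0"
      by (subst lborel.emeasure_pair_measure_alt[OF Ns]) simp
    then show ?thesis using Ns unfolding lborel_prod by (rule null_setsI)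
  qed
  \<comment> \<open>Rational gaps keep the exceptional union countable, yet any two distinct
    minimisers are separated by one of them.\<close>
  have "AE \<theta> in lborel. \<forall>p\<in>{p\<in>\<rat>\<times>\<rat>. fst p < snd p}. \<theta> \<notin> N (fst p) (snd p)"
  proof (subst AE_ball_countable)
    show "countable {p\<in>\<rat>\<times>\<rat>. fst p < (snd p :: real)}"
      by (rule countable_subset[of _ "\<rat> \<times> \<rat>"]) (auto intro!: countable_SIGMA countable_rat)
    show "\<forall>p\<in>{p\<in>\<rat>\<times>\<rat>. fst p < snd p}. AE \<theta> in lborel. \<theta> \<notin> N (fst p) (snd p)"
      using null AE_not_in by blast
  qed
  then show ?thesis
  proof (rule AE_mp, intro AE_I2 impI)
    fix \<theta> assume *: "\<forall>p\<in>{p\<in>\<rat>\<times>\<rat>. fst p < snd p}. \<theta> \<notin> N (fst p) (snd p)"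
    have less: False if "s \<in> argmins T h \<theta>" "t \<in> argmins T h \<theta>" "s < t" for s t
    proof -
      obtain a where a: "a \<in> \<rat>" "s < a" "a < t" using Rats_dense_in_real[OF \<open>s < t\<close>] by blast
      obtain b where b: "b \<in> \<rat>" "a < b" "b < t" using Rats_dense_in_real[OF \<open>a < t\<close>] by blast
      have "s \<in> {0..a}" "t \<in> {b..T}" using that a b by (auto simp: argmins_def)
      then have "\<theta> \<in> N a b" using that unfolding N_def by blast
      then show False using *[rule_format, of "(a, b)"] a b by auto
    qed
    show "\<forall>s\<in>argmins T h \<theta>. \<forall>t\<in>argmins T h \<theta>. s = t"
    proof (intro ballI)
      fix s t assume "s \<in> argmins T h \<theta>" "t \<in> argmins T h \<theta>"
      then show "s = t" using less[of s t] less[of t s] by (cases s t rule: linorder_cases) auto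
    qed
  qed
qed

text \<open>If convergence failed, compactness of \<open>{0..T}\<close> would give a subsequence of
  minimisers, bounded away from the limit minimiser, with a limit \<open>l\<close>. But
  \<open>l\<close> minimises the limit problem, so uniqueness gives a contradiction.\<close>

lemma least_argmin_tendsto:
  fixes h :: "'a::euclidean_space \<times> real \<Rightarrow> real"
  assumes lip: "\<And>k::nat. L-lipschitz_on UNIV (H k)" and conv: "\<And>p. (\<lambda>k. H k p) \<longlonglongrightarrow> h p"
    and h: "continuous_on UNIV h" and T: "0 \<le> T"
    and uniq: "\<forall>s\<in>argmins T h \<theta>. \<forall>t\<in>argmins T h \<theta>. s = t"
  shows "(\<lambda>k. least_argmin T (H k) \<theta>) \<longlonglongrightarrow> least_argmin T h \<theta>"
proof (rule ccontr)
  define t where "t k = least_argmin T (H k) \<theta>" for k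
  define w B where "w = fst \<theta>" and "B = snd \<theta>"
  have L: "0 \<le> L" using lip lipschitz_on_nonneg by blast
  have t: "t k \<in> argmins T (H k) \<theta>" for k
    unfolding t_def by (intro least_argmin_in T lipschitz_on_continuous_on[OF lip])
  then have t_range: "t k \<in> {0..T}" for k by (auto simp: argmins_def)
  assume "\<not> (\<lambda>k. least_argmin T (H k) \<theta>) \<longlonglongrightarrow> least_argmin T h \<theta>"
  then obtain e where e: "e > 0" "\<not> (\<forall>\<^sub>F k in sequentially. dist (t k) (least_argmin T h \<theta>) < e)"
    unfolding tendsto_iff t_def[symmetric] by blast
  have "infinite {k. \<not> dist (t k) (least_argmin T h \<theta>) < e}"
    using e(2) unfolding cofinite_eq_sequentially[symmetric] eventually_cofinite .
  then obtain r :: "nat \<Rightarrow> nat" where r: "strict_mono r" "\<And>k. \<not> dist (t (r k)) (least_argmin T h \<theta>) < e"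
    using infinite_enumerate by blast
  obtain l r' where l: "l \<in> {0..T}" "strict_mono r'" "((t \<circ> r) \<circ> r') \<longlonglongrightarrow> l"
    by (rule seq_compactE[OF compact_imp_seq_compact[OF compact_Icc[of 0 T]], of "t \<circ> r"])
       (use t_range in auto)
  define m where "m k = r (r' k)" for k
  have m: "strict_mono m" using r(1) l(2) by (simp add: m_def strict_mono_def)
  have tm: "(\<lambda>k. t (m k)) \<longlonglongrightarrow> l" using l(3) by (simp add: o_def m_def)
  have Hm: "(\<lambda>k. H (m k) p) \<longlonglongrightarrow> h p" for p
    using LIMSEQ_subseq_LIMSEQ[OF conv[of p] m] by (simp add: o_def)
  \<comment> \<open>Function and evaluation point vary together; the common Lipschitz constant lets
    the point be frozen at \<open>l\<close>, where pointwise convergence applies.\<close>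
  have "(\<lambda>k. H (m k) (w, t (m k)) - H (m k) (w, l)) \<longlonglongrightarrow> 0"
  proof (rule Lim_null_comparison)
    show "\<forall>\<^sub>F k in sequentially. norm (H (m k) (w, t (m k)) - H (m k) (w, l)) \<le> L * \<bar>t (m k) - l\<bar>"
    proof (rule always_eventually, rule allI)
      fix k
      show "norm (H (m k) (w, t (m k)) - H (m k) (w, l)) \<le> L * \<bar>t (m k) - l\<bar>"
        using lipschitz_onD[OF lip[of "m k"], of "(w, t (m k))" "(w, l)"]
        by (simp add: dist_Pair_Pair dist_real_def)
    qed
    show "(\<lambda>k. L * \<bar>t (m k) - l\<bar>) \<longlonglongrightarrow> 0"
      using tendsto_mult_left[OF tendsto_rabs[OF LIM_zero[OF tm]], of L] by simp
  qed
  from tendsto_add[OF this Hm[of "(w, l)"]]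
  have Hl: "(\<lambda>k. H (m k) (w, t (m k))) \<longlonglongrightarrow> h (w, l)" by simp
  have "h (w, l) + l * B \<le> h (w, s) + s * B" if "s \<in> {0..T}" for s
  proof (rule LIMSEQ_le)
    show "(\<lambda>k. H (m k) (w, t (m k)) + t (m k) * B) \<longlonglongrightarrow> h (w, l) + l * B"
      by (intro tendsto_intros Hl tm)
    show "(\<lambda>k. H (m k) (w, s) + s * B) \<longlonglongrightarrow> h (w, s) + s * B"
      by (intro tendsto_intros Hm)
    show "\<exists>N. \<forall>k\<ge>N. H (m k) (w, t (m k)) + t (m k) * B \<le> H (m k) (w, s) + s * B"
      using t that by (auto simp: argmins_def w_def B_def)
  qed
  then have l_in: "l \<in> argmins T h \<theta>" using l(1) by (auto simp: argmins_def w_def B_def)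
  have "l = least_argmin T h \<theta>"
    by (rule uniq[rule_format, OF l_in least_argmin_in[OF h T]])
  then have "(\<lambda>k. dist (t (m k)) (least_argmin T h \<theta>)) \<longlonglongrightarrow> 0"
    using tm tendsto_dist_iff[of "\<lambda>k. t (m k)" l sequentially] by simp
  then have "\<forall>\<^sub>F k in sequentially. dist (t (m k)) (least_argmin T h \<theta>) < e"
    by (rule order_tendstoD(2)) (rule e(1))
  then obtain k where "dist (t (m k)) (least_argmin T h \<theta>) < e"
    using eventually_happens' sequentially_bot by blast
  then show False using r(2)[of "r' k"] by (simp add: m_def)
qed


section \<open>Bounds, Lipschitz estimates and continuity of the dual in the pacing function\<close>

section \<open>The dual function\<close>

lemma integrable_indicator_Icc: "integrable lborel (indicator {a..b} :: real \<Rightarrow> real)"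
  by (rule integrable_real_indicator) (auto simp: emeasure_lborel_Icc_eq)

text \<open>\<open>AE_G\<close> is absolute continuity of \<open>G\<close>, which carries generic
  uniqueness of minimisers over from Lebesgue measure. \<open>item\<close> is stated on the closed
  box because the dual is later clamped to it; \<open>C\<close> and \<open>M\<close> become the
  Lipschitz constants in \<open>w\<close> and \<open>t\<close>.\<close>

locale market = G: prob_space G + F: prob_space F
  for G :: "((real^'d) \<times> real) measure" and F :: "(real^'d) measure" +
  fixes n :: nat and r :: "real^'d \<Rightarrow> real" and U C M :: real
  assumes sets_G [measurable_cong]: "sets G = sets lebesgue"
    and AE_G: "\<And>P. (AE \<theta> in lborel. P \<theta>) \<Longrightarrow> AE \<theta> in G. P \<theta>"
    and sets_F [measurable_cong]: "sets F = sets lebesgue"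
    and r_measurable [measurable]: "r \<in> borel_measurable F"
    and item: "AE \<alpha> in F. 0 < r \<alpha> \<and> norm \<alpha> \<le> C \<and> (\<forall>w\<in>cbox 0 (\<chi> i. U). 0 \<le> w \<bullet> \<alpha> \<and> w \<bullet> \<alpha> \<le> M)"
begin

lemma borel_imp_measurable:
  fixes f :: "(real^'d) \<times> real \<Rightarrow> 'b::topological_space" and f' :: "real^'d \<Rightarrow> 'b"
  shows "f \<in> borel_measurable borel \<Longrightarrow> f \<in> borel_measurable G"
    and "f' \<in> borel_measurable borel \<Longrightarrow> f' \<in> borel_measurable F"
  unfolding measurable_cong_sets[OF sets_G refl] measurable_cong_sets[OF sets_F refl]
  by (rule measurable_completion, simp)+

lemma fst_measurable [measurable]: "(\<lambda>\<theta>. fst \<theta>) \<in> G \<rightarrow>\<^sub>M borel"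
  by (intro borel_imp_measurable borel_measurable_continuous_onI continuous_intros)

lemma ident_measurable_F [measurable]: "(\<lambda>\<alpha>. \<alpha>) \<in> F \<rightarrow>\<^sub>M borel"
  by (intro borel_imp_measurable) simp

lemma space_F [simp]: "space F = UNIV"
  using sets_eq_imp_space_eq[OF sets_F] by simp

abbreviation bid :: "((real^'d) \<times> real \<Rightarrow> real) \<Rightarrow> real^'d \<Rightarrow> (real^'d) \<times> real \<Rightarrow> real" where
  "bid \<mu> \<alpha> \<theta> \<equiv> (fst \<theta> \<bullet> \<alpha>) / (1 + \<mu> \<theta>)"

lemma lam_eq: "lam G \<mu> \<alpha> = distr G borel (bid \<mu> \<alpha>)"
  unfolding lam_def by (simp add: case_prod_beta')

lemma prob_space_lam:
  assumes [measurable]: "\<mu> \<in> borel_measurable G"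
  shows "prob_space (lam G \<mu> \<alpha>)"
  unfolding lam_eq by (rule G.prob_space_distr) measurable

text \<open>Joint measurability in item and price: the distribution function is the
  \<open>G\<close>-measure of sections of one measurable set of triples (item, price, type).\<close>

lemma Hcdf_measurable [measurable]:
  assumes [measurable]: "\<mu> \<in> borel_measurable G"
  shows "(\<lambda>x. Hcdf n G \<mu> (fst x) (snd x)) \<in> borel_measurable (F \<Otimes>\<^sub>M borel)"
proof -
  define Q where "Q = {x \<in> space ((F \<Otimes>\<^sub>M borel) \<Otimes>\<^sub>M G). bid \<mu> (fst (fst x)) (snd x) \<le> snd (fst x)}"
  have Q: "Q \<in> sets ((F \<Otimes>\<^sub>M borel) \<Otimes>\<^sub>M G)"
    unfolding Q_def by measurable
  have "measure (lam G \<mu> (fst x)) {..snd x} = measure G (Pair x -` Q)" for x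
    unfolding lam_eq
    by (subst measure_distr)
       (auto simp: Q_def space_pair_measure intro!: arg_cong2[of _ _ _ _ measure])
  moreover have "(\<lambda>x. measure G (Pair x -` Q)) \<in> borel_measurable (F \<Otimes>\<^sub>M borel)"
    unfolding measure_def
    by (intro borel_measurable_enn2real G.measurable_emeasure_Pair Q)
  ultimately show ?thesis
    unfolding Hcdf_def by simp
qed

lemma Hcdf_measurable_price [measurable]:
  assumes [measurable]: "\<mu> \<in> borel_measurable G"
  shows "Hcdf n G \<mu> \<alpha> \<in> borel_measurable borel"
proof -
  have "(\<lambda>s. (\<alpha>, s)) \<in> borel \<rightarrow>\<^sub>M F \<Otimes>\<^sub>M borel" by (intro measurable_Pair1') simp_all
  from measurable_compose[OF this Hcdf_measurable[OF assms]] show ?thesis by simp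
qed

lemma Hcdf_nonneg: "0 \<le> Hcdf n G \<mu> \<alpha> s"
  by (simp add: Hcdf_def)

lemma Hcdf_le_1:
  assumes "\<mu> \<in> borel_measurable G"
  shows "Hcdf n G \<mu> \<alpha> s \<le> 1"
  unfolding Hcdf_def using prob_space.prob_le_1[OF prob_space_lam[OF assms]]
  by (intro power_le_one) auto

text \<open>Expected surplus of a bidder with value \<open>x\<close> in a second-price auction with
  reserve \<open>r \<alpha>\<close>, when \<open>Hcdf\<close> is the distribution function of the
  highest rival bid. Below the reserve the interval is empty, which absorbs the case distinction in
  \<open>qdual\<close>.\<close>

definition surplus :: "((real^'d) \<times> real \<Rightarrow> real) \<Rightarrow> real^'d \<Rightarrow> real \<Rightarrow> real" where
  "surplus \<mu> \<alpha> x = (LINT s|lborel. indicator {r \<alpha>..x} s * Hcdf n G \<mu> \<alpha> s)"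

lemma qdual_eq:
  "qdual n G F r \<mu> w B t = (\<integral>\<alpha>. (1 + t) * surplus \<mu> \<alpha> ((w \<bullet> \<alpha>) / (1 + t)) \<partial>F) + t * B"
proof -
  have "(if (w \<bullet> \<alpha>) / (1 + t) \<ge> r \<alpha> then (LBINT s:{r \<alpha> .. (w \<bullet> \<alpha>) / (1 + t)}. Hcdf n G \<mu> \<alpha> s) else 0)
      = surplus \<mu> \<alpha> ((w \<bullet> \<alpha>) / (1 + t))" for \<alpha>
    by (simp add: surplus_def set_lebesgue_integral_def)
  then show ?thesis by (simp add: qdual_def)
qed

lemma surplus_measurable:
  assumes [measurable]: "\<mu> \<in> borel_measurable G"
  shows "(\<lambda>\<alpha>. surplus \<mu> \<alpha> ((w \<bullet> \<alpha>) / (1 + t))) \<in> borel_measurable F"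
  unfolding surplus_def
proof (rule lborel.borel_measurable_lebesgue_integral)
  have "(\<lambda>x. indicator {s. r (fst x) \<le> s \<and> s \<le> (w \<bullet> fst x) / (1 + t)} (snd x) * Hcdf n G \<mu> (fst x) (snd x))
      \<in> borel_measurable (F \<Otimes>\<^sub>M lborel)"
    by measurable
  then show "(\<lambda>(\<alpha>, s). indicator {r \<alpha>..(w \<bullet> \<alpha>) / (1 + t)} s * Hcdf n G \<mu> \<alpha> s) \<in> borel_measurable (F \<Otimes>\<^sub>M lborel)"
    by (simp add: case_prod_beta' atLeastAtMost_def atLeast_def atMost_def Collect_conj_eq[symmetric])
qed

lemma integrable_surplus:
  assumes [measurable]: "\<mu> \<in> borel_measurable G"
  shows "integrable lborel (\<lambda>s. indicator {a..x} s * Hcdf n G \<mu> \<alpha> s)"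
proof (rule Bochner_Integration.integrable_bound)
  show "integrable lborel (indicator {a..x} :: real \<Rightarrow> real)" by (rule integrable_indicator_Icc)
  show "AE s in lborel. norm (indicator {a..x} s * Hcdf n G \<mu> \<alpha> s) \<le> norm (indicator {a..x} s :: real)"
    by (intro AE_I2) (auto simp: indicator_def Hcdf_nonneg Hcdf_le_1)
qed measurable

text \<open>The integrand takes values between 0 and 1, and \<open>{r \<alpha>..y}\<close> is
  covered by \<open>{r \<alpha>..x}\<close> and \<open>{x..y}\<close>, also when
  \<open>r \<alpha>\<close> exceeds \<open>x\<close>.\<close>

lemma surplus_mono_lipschitz:
  assumes \<mu>: "\<mu> \<in> borel_measurable G" and "x \<le> y"
  shows "surplus \<mu> \<alpha> x \<le> surplus \<mu> \<alpha> y" "surplus \<mu> \<alpha> y \<le> surplus \<mu> \<alpha> x + (y - x)"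
proof -
  show "surplus \<mu> \<alpha> x \<le> surplus \<mu> \<alpha> y"
    unfolding surplus_def using \<open>x \<le> y\<close>
    by (intro integral_mono integrable_surplus \<mu>) (auto simp: indicator_def Hcdf_nonneg)
  have "surplus \<mu> \<alpha> y \<le> (LINT s|lborel. indicator {r \<alpha>..x} s * Hcdf n G \<mu> \<alpha> s + indicator {x..y} s)"
    unfolding surplus_def using \<open>x \<le> y\<close>
    by (intro integral_mono integrable_surplus \<mu> Bochner_Integration.integrable_add integrable_indicator_Icc)
       (auto simp: indicator_def Hcdf_nonneg Hcdf_le_1[OF \<mu>] intro: add_nonneg_nonneg)
  also have "\<dots> = surplus \<mu> \<alpha> x + (y - x)"
    unfolding surplus_def using \<open>x \<le> y\<close>
    by (subst Bochner_Integration.integral_add) (auto intro: integrable_surplus integrable_indicator_Icc \<mu>)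
  finally show "surplus \<mu> \<alpha> y \<le> surplus \<mu> \<alpha> x + (y - x)" .
qed

lemma surplus_bounds:
  assumes "\<mu> \<in> borel_measurable G" "0 < r \<alpha>" "0 \<le> x"
  shows "0 \<le> surplus \<mu> \<alpha> x" "surplus \<mu> \<alpha> x \<le> x"
proof -
  have "surplus \<mu> \<alpha> 0 = 0" using assms by (simp add: surplus_def)
  then show "0 \<le> surplus \<mu> \<alpha> x" "surplus \<mu> \<alpha> x \<le> x"
    using surplus_mono_lipschitz[of \<mu> 0 x \<alpha>] assms by auto
qed

lemma scaled_surplus_bounds:
  assumes "\<mu> \<in> borel_measurable G" "0 < r \<alpha>" "0 \<le> c" "0 \<le> t"
  shows "0 \<le> (1 + t) * surplus \<mu> \<alpha> (c / (1 + t))" "(1 + t) * surplus \<mu> \<alpha> (c / (1 + t)) \<le> c"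
proof -
  note b = surplus_bounds[OF assms(1,2), of "c / (1 + t)"]
  show "0 \<le> (1 + t) * surplus \<mu> \<alpha> (c / (1 + t))" using b assms by simp
  have "(1 + t) * surplus \<mu> \<alpha> (c / (1 + t)) \<le> (1 + t) * (c / (1 + t))"
    using b assms by (intro mult_left_mono) auto
  then show "(1 + t) * surplus \<mu> \<alpha> (c / (1 + t)) \<le> c" using assms by simp
qed

text \<open>The outer factor \<open>1 + t\<close> cancels the division by \<open>1 + t\<close>
  inside the 1-Lipschitz \<open>surplus\<close>, so the constant is 1 for every
  \<open>t\<close>.\<close>

lemma scaled_surplus_lipschitz_value:
  assumes \<mu>: "\<mu> \<in> borel_measurable G" and t: "0 \<le> t"
  shows "\<bar>(1 + t) * surplus \<mu> \<alpha> (c / (1 + t)) - (1 + t) * surplus \<mu> \<alpha> (c' / (1 + t))\<bar> \<le> \<bar>c - c'\<bar>"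
proof (induction c c' rule: linorder_wlog)
  case (le a b)
  have ab: "a / (1 + t) \<le> b / (1 + t)" using le t by (simp add: divide_right_mono)
  have "(1 + t) * surplus \<mu> \<alpha> (a / (1 + t)) \<le> (1 + t) * surplus \<mu> \<alpha> (b / (1 + t))"
    using t surplus_mono_lipschitz(1)[OF \<mu> ab] by (intro mult_left_mono) auto
  moreover have "(1 + t) * surplus \<mu> \<alpha> (b / (1 + t)) 
      \<le> (1 + t) * (surplus \<mu> \<alpha> (a / (1 + t)) + (b / (1 + t) - a / (1 + t)))"
    using t surplus_mono_lipschitz(2)[OF \<mu> ab] by (intro mult_left_mono) auto
  moreover have "\<dots> = (1 + t) * surplus \<mu> \<alpha> (a / (1 + t)) + (b - a)"
    using t by (simp add: distrib_left right_diff_distrib)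
  ultimately show ?case using le by linarith
qed (simp add: abs_minus_commute)

text \<open>The perspective \<open>(1 + t) * surplus (c / (1 + t))\<close> is Lipschitz in \<open>t\<close> although the factor
  \<open>1 + t\<close> is unbounded, because \<open>surplus\<close> is monotone, 1-Lipschitz and vanishes at \<open>0\<close>.\<close>

lemma scaled_surplus_lipschitz_pacing:
  assumes \<mu>: "\<mu> \<in> borel_measurable G" and r: "0 < r \<alpha>" and c: "0 \<le> c" and s: "0 \<le> s" and t: "0 \<le> t"
  shows "\<bar>(1 + s) * surplus \<mu> \<alpha> (c / (1 + s)) - (1 + t) * surplus \<mu> \<alpha> (c / (1 + t))\<bar> \<le> c * \<bar>s - t\<bar>"
  using s t
proof (induction s t rule: linorder_wlog)
  case (le s t)
  have st: "0 \<le> s" "0 \<le> t" "s \<le> t" using le by auto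
  define x y where "x = c / (1 + t)" and "y = c / (1 + s)"
  have x: "0 \<le> x" "x \<le> c" and xy: "x \<le> y"
    using c st divide_left_mono[of 1 "1 + t" c] divide_left_mono[of "1 + s" "1 + t" c] by (auto simp: x_def y_def)
  have "(1 + s) * surplus \<mu> \<alpha> x \<le> (1 + s) * surplus \<mu> \<alpha> y"
    using st surplus_mono_lipschitz(1)[OF \<mu> xy] by (intro mult_left_mono) auto
  moreover have "(1 + s) * surplus \<mu> \<alpha> y \<le> (1 + s) * (surplus \<mu> \<alpha> x + (y - x))"
    using st surplus_mono_lipschitz(2)[OF \<mu> xy] by (intro mult_left_mono) auto
  \<comment> \<open>Both \<open>(1 + s) * y\<close> and \<open>(1 + t) * x\<close> equal
    \<open>c\<close>; this turns the change of the paced bid into the change of the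
    multiplier.\<close>
  moreover have "(1 + s) * (y - x) = x * (t - s)"
  proof -
    have "(1 + s) * y = c" "(1 + t) * x = c" using st by (auto simp: x_def y_def)
    then show ?thesis by (simp add: algebra_simps)
  qed
  moreover have "(t - s) * surplus \<mu> \<alpha> x \<le> (t - s) * x" "0 \<le> (t - s) * surplus \<mu> \<alpha> x" "x * (t - s) \<le> c * (t - s)"
    using st surplus_bounds[OF \<mu> r x(1)] x by (auto intro: mult_left_mono mult_right_mono)
  ultimately show ?case
    using st unfolding x_def[symmetric] y_def[symmetric] by (simp add: algebra_simps abs_le_iff) 
qed (simp add: abs_minus_commute)

lemma scaled_surplus_AE_bounds:
  assumes \<mu>: "\<mu> \<in> borel_measurable G" and w: "w \<in> cbox 0 (\<chi> i. U)" and t: "0 \<le> t"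
  shows "AE \<alpha> in F. 0 \<le> (1 + t) * surplus \<mu> \<alpha> ((w \<bullet> \<alpha>) / (1 + t)) \<and>
           (1 + t) * surplus \<mu> \<alpha> ((w \<bullet> \<alpha>) / (1 + t)) \<le> M"
  using item
proof eventually_elim
  case (elim \<alpha>)
  then have "0 < r \<alpha>" "0 \<le> w \<bullet> \<alpha>" "w \<bullet> \<alpha> \<le> M" using w by auto
  then show ?case using scaled_surplus_bounds[OF \<mu> _ _ t, of \<alpha> "w \<bullet> \<alpha>"] by linarith
qed

lemma integrable_scaled_surplus:
  assumes \<mu>: "\<mu> \<in> borel_measurable G" and w: "w \<in> cbox 0 (\<chi> i. U)" and t: "0 \<le> t"
  shows "integrable F (\<lambda>\<alpha>. (1 + t) * surplus \<mu> \<alpha> ((w \<bullet> \<alpha>) / (1 + t)))"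
proof (rule F.integrable_const_bound[of _ M])
  show "AE \<alpha> in F. norm ((1 + t) * surplus \<mu> \<alpha> ((w \<bullet> \<alpha>) / (1 + t))) \<le> M"
    using scaled_surplus_AE_bounds[OF assms] by eventually_elim simp
qed (intro borel_measurable_times borel_measurable_const surplus_measurable \<mu>)

lemma qdual_bounds:
  assumes \<mu>: "\<mu> \<in> borel_measurable G" and w: "w \<in> cbox 0 (\<chi> i. U)" and t: "0 \<le> t"
  shows "0 \<le> qdual n G F r \<mu> w 0 t" "qdual n G F r \<mu> w 0 t \<le> M"
proof -
  note bounds = scaled_surplus_AE_bounds[OF assms]
  show "0 \<le> qdual n G F r \<mu> w 0 t"
    unfolding qdual_eq mult_zero_right add_0_right
    by (rule integral_nonneg_AE) (use bounds in auto)
  show "qdual n G F r \<mu> w 0 t \<le> M"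
    unfolding qdual_eq mult_zero_right add_0_right
    by (rule F.integral_le_const[OF integrable_scaled_surplus[OF assms]]) (use bounds in auto)
qed

lemma qdual_lipschitz:
  assumes \<mu>: "\<mu> \<in> borel_measurable G"
    and w: "w \<in> cbox 0 (\<chi> i. U)" "w' \<in> cbox 0 (\<chi> i. U)" and t: "0 \<le> t" "0 \<le> t'"
  shows "\<bar>qdual n G F r \<mu> w 0 t - qdual n G F r \<mu> w' 0 t'\<bar> \<le> C * dist w w' + M * dist t t'"
proof -
  let ?P = "\<lambda>w t \<alpha>. (1 + t) * surplus \<mu> \<alpha> ((w \<bullet> \<alpha>) / (1 + t))"
  have int: "integrable F (?P w t)" "integrable F (?P w' t')"
    using integrable_scaled_surplus \<mu> w t by auto
  have "AE \<alpha> in F. norm (?P w t \<alpha> - ?P w' t' \<alpha>) \<le> C * dist w w' + M * dist t t'"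
    using item
  proof eventually_elim
    case (elim \<alpha>)
    have "\<bar>?P w t \<alpha> - ?P w' t \<alpha>\<bar> \<le> \<bar>w \<bullet> \<alpha> - w' \<bullet> \<alpha>\<bar>"
      by (rule scaled_surplus_lipschitz_value[OF \<mu> t(1)])
    also have "\<dots> \<le> norm (w - w') * norm \<alpha>"
      unfolding inner_diff_left[symmetric] by (rule Cauchy_Schwarz_ineq2)
    also have "\<dots> \<le> C * dist w w'"
      unfolding dist_norm using elim by (subst mult.commute) (auto intro: mult_right_mono)
    finally have 1: "\<bar>?P w t \<alpha> - ?P w' t \<alpha>\<bar> \<le> C * dist w w'" .
    have "\<bar>?P w' t \<alpha> - ?P w' t' \<alpha>\<bar> \<le> (w' \<bullet> \<alpha>) * \<bar>t - t'\<bar>"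
      using elim w t by (intro scaled_surplus_lipschitz_pacing \<mu>) auto
    also have "\<dots> \<le> M * dist t t'"
      using elim w by (auto simp: dist_real_def intro: mult_right_mono)
    finally show ?case using 1 by simp
  qed
  then have "norm (\<integral>\<alpha>. ?P w t \<alpha> - ?P w' t' \<alpha> \<partial>F) \<le> C * dist w w' + M * dist t t'"
    by (intro order_trans[OF integral_norm_bound] F.integral_le_const integrable_norm
        Bochner_Integration.integrable_diff int)
  then show ?thesis
    using int by (simp add: qdual_eq)
qed

text \<open>The distribution function is the expectation of an indicator of the bid. Away from an
  atom the limit bid almost surely differs from \<open>s\<close>, so the indicator is eventually
  constant and dominated convergence applies.\<close>

lemma lam_tendsto:
  assumes \<mu>: "\<mu> \<in> borel_measurable G" "\<And>\<theta>. 0 \<le> \<mu> \<theta>" and m: "\<And>k::nat. m k \<in> borel_measurable G"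
    and conv: "AE \<theta> in G. (\<lambda>k. m k \<theta>) \<longlonglongrightarrow> \<mu> \<theta>"
    and atom: "measure (lam G \<mu> \<alpha>) {s} = 0"
  shows "(\<lambda>k. measure (lam G (m k) \<alpha>) {..s}) \<longlonglongrightarrow> measure (lam G \<mu> \<alpha>) {..s}"
proof -
  note [measurable] = \<mu>(1) m
  have measure_eq: "measure (lam G \<nu> \<alpha>) {..s} = (\<integral>\<theta>. indicator {..s} (bid \<nu> \<alpha> \<theta>) \<partial>G)"
    if [measurable]: "\<nu> \<in> borel_measurable G" for \<nu>
  proof -
    have "measure (lam G \<nu> \<alpha>) {..s} = (\<integral>x. indicator {..s} x \<partial>lam G \<nu> \<alpha>)"
      by (simp add: lam_eq)
    then show ?thesis unfolding lam_eq by (subst (asm) integral_distr) simp_all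
  qed
  interpret l: prob_space "lam G \<mu> \<alpha>" by (rule prob_space_lam) measurable
  have "AE x in lam G \<mu> \<alpha>. x \<noteq> s"
  proof (rule AE_I[of _ _ "{s}"])
    show "emeasure (lam G \<mu> \<alpha>) {s} = 0" by (simp add: l.emeasure_eq_measure atom)
    show "{s} \<in> sets (lam G \<mu> \<alpha>)" by (simp add: lam_eq)
  qed auto
  then have ne: "AE \<theta> in G. bid \<mu> \<alpha> \<theta> \<noteq> s"
    unfolding lam_eq by (subst (asm) AE_distr_iff) auto
  have "(\<lambda>k. \<integral>\<theta>. indicator {..s} (bid (m k) \<alpha> \<theta>) \<partial>G) \<longlonglongrightarrow> (\<integral>\<theta>. indicator {..s} (bid \<mu> \<alpha> \<theta>) \<partial>G :: real)"
  proof (rule integral_dominated_convergence[where w = "\<lambda>_. 1"])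
    show "AE \<theta> in G. (\<lambda>k. indicator {..s} (bid (m k) \<alpha> \<theta>) :: real) \<longlonglongrightarrow> indicator {..s} (bid \<mu> \<alpha> \<theta>)"
      using conv ne
    proof eventually_elim
      case (elim \<theta>)
      have lim: "(\<lambda>k. bid (m k) \<alpha> \<theta>) \<longlonglongrightarrow> bid \<mu> \<alpha> \<theta>"
        using elim(1) \<mu>(2)[of \<theta>] by (intro tendsto_intros) auto
      have "\<forall>\<^sub>F k in sequentially. bid (m k) \<alpha> \<theta> \<le> s \<longleftrightarrow> bid \<mu> \<alpha> \<theta> \<le> s"
      proof (cases "bid \<mu> \<alpha> \<theta> < s")
        case True
        show ?thesis
          by (rule eventually_mono[OF order_tendstoD(2)[OF lim True]]) (use True in simp)
      next
        case False
        then have "s < bid \<mu> \<alpha> \<theta>" using elim(2) by simp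
        then show ?thesis
          by (intro eventually_mono[OF order_tendstoD(1)[OF lim]]) (simp_all add: not_le)
      qed
      then show ?case
        by (intro tendsto_eventually) (auto elim!: eventually_mono simp: indicator_def)
    qed
  qed (auto simp: indicator_def)
  then show ?thesis by (simp add: measure_eq m \<mu>)
qed

text \<open>Dominated convergence twice: over prices, where the atoms of the limit distribution are
  countable and hence null, and then over items with the constant bound \<open>M\<close>.\<close>

lemma qdual_tendsto:
  assumes \<mu>: "\<mu> \<in> borel_measurable G" "\<And>\<theta>. 0 \<le> \<mu> \<theta>" and m: "\<And>k::nat. m k \<in> borel_measurable G"
    and conv: "AE \<theta> in G. (\<lambda>k. m k \<theta>) \<longlonglongrightarrow> \<mu> \<theta>"
    and w: "w \<in> cbox 0 (\<chi> i. U)" and t: "0 \<le> t"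
  shows "(\<lambda>k. qdual n G F r (m k) w B t) \<longlonglongrightarrow> qdual n G F r \<mu> w B t"
proof -
  note [measurable] = \<mu>(1) m
  have surplus: "(\<lambda>k. surplus (m k) \<alpha> x) \<longlonglongrightarrow> surplus \<mu> \<alpha> x" for \<alpha> x
    unfolding surplus_def
  proof (rule integral_dominated_convergence[where w = "indicator {r \<alpha>..x}"])
    interpret l: prob_space "lam G \<mu> \<alpha>" by (rule prob_space_lam) measurable
    have "AE s in lborel. s \<notin> {s. measure (lam G \<mu> \<alpha>) {s} \<noteq> 0}"
      by (rule AE_not_in, rule countable_imp_null_set_lborel, rule l.countable_support)
    then show "AE s in lborel. (\<lambda>k. indicator {r \<alpha>..x} s * Hcdf n G (m k) \<alpha> s) 
                 \<longlonglongrightarrow> indicator {r \<alpha>..x} s * Hcdf n G \<mu> \<alpha> s"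
    proof eventually_elim
      case (elim s)
      then show ?case
        unfolding Hcdf_def by (intro tendsto_mult tendsto_const tendsto_power lam_tendsto[OF \<mu> m conv]) simp
    qed
    show "AE s in lborel. norm (indicator {r \<alpha>..x} s * Hcdf n G (m k) \<alpha> s) \<le> indicator {r \<alpha>..x} s" for k
      by (intro AE_I2) (simp add: indicator_def Hcdf_nonneg Hcdf_le_1[OF m])
    show "(\<lambda>s. indicator {r \<alpha>..x} s * Hcdf n G (m k) \<alpha> s) \<in> borel_measurable lborel" for k
      by measurable
    show "(\<lambda>s. indicator {r \<alpha>..x} s * Hcdf n G \<mu> \<alpha> s) \<in> borel_measurable lborel"
      by measurable
  qed (rule integrable_indicator_Icc)
  have "(\<lambda>k. \<integral>\<alpha>. (1 + t) * surplus (m k) \<alpha> ((w \<bullet> \<alpha>) / (1 + t)) \<partial>F)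
      \<longlonglongrightarrow> (\<integral>\<alpha>. (1 + t) * surplus \<mu> \<alpha> ((w \<bullet> \<alpha>) / (1 + t)) \<partial>F)"
  proof (rule integral_dominated_convergence[where w = "\<lambda>_. M"])
    show "AE \<alpha> in F. norm ((1 + t) * surplus (m k) \<alpha> ((w \<bullet> \<alpha>) / (1 + t))) \<le> M" for k
      using scaled_surplus_AE_bounds[OF m[of k] w t] by eventually_elim simp
    show "AE \<alpha> in F. (\<lambda>k. (1 + t) * surplus (m k) \<alpha> ((w \<bullet> \<alpha>) / (1 + t)))
        \<longlonglongrightarrow> (1 + t) * surplus \<mu> \<alpha> ((w \<bullet> \<alpha>) / (1 + t))"
      by (intro AE_I2 tendsto_mult tendsto_const surplus)
    show "(\<lambda>\<alpha>. (1 + t) * surplus \<mu> \<alpha> ((w \<bullet> \<alpha>) / (1 + t))) \<in> borel_measurable F"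
      by (rule borel_measurable_integrable[OF integrable_scaled_surplus[OF \<mu>(1) w t]])
    show "(\<lambda>\<alpha>. (1 + t) * surplus (m k) \<alpha> ((w \<bullet> \<alpha>) / (1 + t))) \<in> borel_measurable F" for k
      by (rule borel_measurable_integrable[OF integrable_scaled_surplus[OF m w t]])
  qed simp
  then show ?thesis unfolding qdual_eq by (intro tendsto_add tendsto_const)
qed

end

section \<open>Existence of a pacing function that is optimal against itself\<close>

section \<open>Equilibrium\<close>

context market
begin

text \<open>The fixed point theorem concerns functions on the whole space. Clamping to the box of
  valuations and multipliers does not increase distances, so it extends the dual without enlarging
  its Lipschitz constant.\<close>

abbreviation truncate :: "real \<Rightarrow> (real^'d) \<times> real \<Rightarrow> (real^'d) \<times> real" where
  "truncate T \<equiv> clamp (0, 0) (\<chi> i. U, T)"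

lemma truncate_range:
  assumes "0 \<le> U" "0 \<le> T"
  shows "fst (truncate T p) \<in> cbox 0 (\<chi> i. U)" "snd (truncate T p) \<in> {0..T}"
proof -
  have "truncate T p \<in> cbox (0, 0) (\<chi> i. U, T)"
    by (rule clamp_in_interval) (use assms in \<open>auto simp: Basis_prod_def inner_axis Basis_vec_def\<close>)
  then show "fst (truncate T p) \<in> cbox 0 (\<chi> i. U)" "snd (truncate T p) \<in> {0..T}"
    by (auto simp: cbox_Pair_eq)
qed

lemma truncate_ident:
  assumes "w \<in> cbox 0 (\<chi> i. U)" "t \<in> {0..T}"
  shows "truncate T (w, t) = (w, t)"
  by (rule clamp_cancel_cbox) (use assms in \<open>simp add: cbox_Pair_eq\<close>)

text \<open>A fixed point \<open>h\<close> is the budget-free dual of its own least minimiser.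
  Almost everywhere reasoning enters only through the continuity of \<open>\<Psi>\<close>; the
  selected multiplier is optimal on \<open>{0..T}\<close> for every \<open>w\<close> in the box and
  every budget.\<close>

lemma pacing_equilibrium:
  assumes U: "0 \<le> U" and T: "0 \<le> T" and M: "0 < M" and C: "0 \<le> C"
  shows "\<exists>\<mu>\<in>borel_measurable borel. (\<forall>\<theta>. \<mu> \<theta> \<in> {0..T}) \<and>
    (\<forall>w\<in>cbox 0 (\<chi> i. U). \<forall>B. \<forall>t\<in>{0..T}.
       qdual n G F r \<mu> w B (\<mu> (w, B)) \<le> qdual n G F r \<mu> w B t)"
proof -
  define \<Psi> where "\<Psi> h p = qdual n G F r (least_argmin T h) (fst (truncate T p)) 0 (snd (truncate T p))"
    for h p
  note tr = truncate_range[OF U T]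
  have cont: "continuous_on UNIV h" if "(C + M)-lipschitz_on UNIV h" for h :: "(real^'d) \<times> real \<Rightarrow> real"
    using that by (rule lipschitz_on_continuous_on)
  have meas: "least_argmin T h \<in> borel_measurable G" if "(C + M)-lipschitz_on UNIV h" for h :: "(real^'d) \<times> real \<Rightarrow> real"
    by (intro borel_imp_measurable least_argmin_measurable cont[OF that] T)
  have argmin: "least_argmin T h \<theta> \<in> argmins T h \<theta>" if "(C + M)-lipschitz_on UNIV h" for h :: "(real^'d) \<times> real \<Rightarrow> real" and \<theta>
    by (rule least_argmin_in[OF cont[OF that] T])
  have nonneg: "0 \<le> least_argmin T h \<theta>" if "(C + M)-lipschitz_on UNIV h" for h :: "(real^'d) \<times> real \<Rightarrow> real" and \<theta>
    using argmin[OF that, of \<theta>] by (simp add: argmins_def)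
  have "0 \<le> C + M" using M C by simp
  obtain h where h: "(C + M)-lipschitz_on UNIV h" "\<Psi> h = h"
  proof (rule lipschitz_fixpoint[OF M \<open>0 \<le> C + M\<close>, of \<Psi>])
    fix h :: "(real^'d) \<times> real \<Rightarrow> real" assume lip: "(C + M)-lipschitz_on UNIV h"
    show "\<Psi> h p \<in> {0..M}" for p
      unfolding \<Psi>_def using qdual_bounds[OF meas[OF lip] tr(1)] tr(2)[of p] by auto
    show "(C + M)-lipschitz_on UNIV (\<Psi> h)"
    proof (rule lipschitz_onI[OF _ \<open>0 \<le> C + M\<close>])
      fix p p'
      let ?x = "truncate T p" and ?y = "truncate T p'"
      have "dist (\<Psi> h p) (\<Psi> h p') \<le> C * dist (fst ?x) (fst ?y) + M * dist (snd ?x) (snd ?y)"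
        unfolding \<Psi>_def dist_real_def[of "qdual _ _ _ _ _ _ _ _"]
        using tr(2)[of p] tr(2)[of p'] by (intro qdual_lipschitz meas lip tr(1)) auto
      also have "\<dots> \<le> C * dist ?x ?y + M * dist ?x ?y"
        using M C by (intro add_mono mult_left_mono dist_fst_le dist_snd_le) auto
      also have "\<dots> \<le> (C + M) * dist p p'"
        using \<open>0 \<le> C + M\<close> unfolding distrib_right[symmetric]
        by (intro mult_left_mono dist_clamps_le_dist_args)
      finally show "dist (\<Psi> h p) (\<Psi> h p') \<le> (C + M) * dist p p'" .
    qed
  next
    fix H :: "nat \<Rightarrow> (real^'d) \<times> real \<Rightarrow> real" and h p
    assume lip: "\<And>k. (C + M)-lipschitz_on UNIV (H k)" and lim: "\<And>p. (\<lambda>k. H k p) \<longlonglongrightarrow> h p"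
    have lip_h: "(C + M)-lipschitz_on UNIV h"
    proof (rule lipschitz_onI[OF _ \<open>0 \<le> C + M\<close>])
      show "dist (h p) (h p') \<le> (C + M) * dist p p'" for p p'
        by (rule LIMSEQ_le_const2[OF tendsto_dist[OF lim lim]])
           (use lipschitz_onD[OF lip] in blast)
    qed
    have "AE \<theta> in G. (\<lambda>k. least_argmin T (H k) \<theta>) \<longlonglongrightarrow> least_argmin T h \<theta>"
    proof (rule AE_G)
      show "AE \<theta> in lborel. (\<lambda>k. least_argmin T (H k) \<theta>) \<longlonglongrightarrow> least_argmin T h \<theta>"
        using AE_argmins_unique[OF cont[OF lip_h], of T]
      proof eventually_elim
        case (elim \<theta>)
        show ?case by (rule least_argmin_tendsto[OF lip lim cont[OF lip_h] T elim])
      qed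
    qed
    then show "(\<lambda>k. \<Psi> (H k) p) \<longlonglongrightarrow> \<Psi> h p"
      unfolding \<Psi>_def using tr(2)[of p]
      by (intro qdual_tendsto meas lip lip_h nonneg tr(1)) auto
  qed
  define \<mu> where "\<mu> = least_argmin T h"
  have "qdual n G F r \<mu> w B (\<mu> (w, B)) \<le> qdual n G F r \<mu> w B t"
    if w: "w \<in> cbox 0 (\<chi> i. U)" and t: "t \<in> {0..T}" for w B t
  proof -
    have h_eq: "h (w, s) + s * B = qdual n G F r \<mu> w B s" if "s \<in> {0..T}" for s
    proof -
      have "h (w, s) = \<Psi> h (w, s)" using h(2) by simp
      also have "\<dots> = qdual n G F r \<mu> w 0 s"
        unfolding \<Psi>_def truncate_ident[OF w that] by (simp add: \<mu>_def)
      finally show ?thesis by (simp add: qdual_def)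
    qed
    have "\<mu> (w, B) \<in> {0..T}" "h (w, \<mu> (w, B)) + \<mu> (w, B) * B \<le> h (w, t) + t * B"
      using argmin[OF h(1), of "(w, B)"] t by (auto simp: argmins_def \<mu>_def)
    then show ?thesis using h_eq t by simp
  qed
  moreover have "\<mu> \<in> borel_measurable borel"
    unfolding \<mu>_def by (rule least_argmin_measurable[OF cont[OF h(1)] T])
  moreover have "\<mu> \<theta> \<in> {0..T}" for \<theta>
    using argmin[OF h(1), of \<theta>] by (simp add: argmins_def \<mu>_def)
  ultimately show ?thesis by blast
qed

text \<open>Beyond \<open>T = M / b\<close> the budget term alone exceeds the value of the dual at \<open>0\<close>.\<close>

lemma pacing_equilibrium_unbounded:
  assumes U: "0 \<le> U" and M: "0 < M" and C: "0 \<le> C" and b: "0 < b"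
  shows "\<exists>\<mu>\<in>borel_measurable borel. (\<forall>\<theta>. 0 \<le> \<mu> \<theta>) \<and>
    (\<forall>w\<in>cbox 0 (\<chi> i. U). \<forall>B\<ge>b. \<forall>t\<ge>0.
       qdual n G F r \<mu> w B (\<mu> (w, B)) \<le> qdual n G F r \<mu> w B t)"
proof -
  have T: "0 \<le> M / b" using M b by simp
  obtain \<mu> where \<mu>: "\<mu> \<in> borel_measurable borel" "\<forall>\<theta>. \<mu> \<theta> \<in> {0..M / b}"
    and opt: "\<forall>w\<in>cbox 0 (\<chi> i. U). \<forall>B. \<forall>t\<in>{0..M / b}.
       qdual n G F r \<mu> w B (\<mu> (w, B)) \<le> qdual n G F r \<mu> w B t"
    using pacing_equilibrium[OF U T M C] by blast
  have "qdual n G F r \<mu> w B (\<mu> (w, B)) \<le> qdual n G F r \<mu> w B t"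
    if w: "w \<in> cbox 0 (\<chi> i. U)" and B: "b \<le> B" and t: "0 \<le> t" for w B t
  proof (cases "t \<le> M / b")
    case True
    then show ?thesis using opt w t by simp
  next
    case False
    note bounds = qdual_bounds[OF borel_imp_measurable(1)[OF \<mu>(1)] w]
    have "qdual n G F r \<mu> w B (\<mu> (w, B)) \<le> qdual n G F r \<mu> w B 0"
      using opt w T by simp
    also have "\<dots> \<le> M" using bounds(2)[of 0] by (simp add: qdual_def)
    also have "\<dots> \<le> t * b" using False b by (simp add: field_simps)
    also have "\<dots> \<le> t * B" using B t by (rule mult_left_mono)
    also have "\<dots> \<le> qdual n G F r \<mu> w B t" using bounds(1)[OF t] by (simp add: qdual_def)
    finally show ?thesis .
  qed
  then show ?thesis using \<mu> by (intro bexI[of _ \<mu>]) auto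
qed

end

theorem theorem3:
  fixes n :: nat and U Bmin \<omega> :: real
    and A :: "(real^'d) set"
    and F :: "(real^'d) measure" and f :: "real^'d \<Rightarrow> ennreal"
    and G :: "((real^'d) \<times> real) measure" and g :: "(real^'d) \<times> real \<Rightarrow> ennreal"
    and r :: "real^'d \<Rightarrow> real"
  assumes n2: "n \<ge> 2"
    and d2: "CARD('d) \<ge> 2"
    and U_pos: "U > 0" and Bmin_pos: "Bmin > 0"
    and A_meas: "A \<in> sets lebesgue"
    and A_pos: "\<forall>\<alpha>\<in>A. \<forall>i. \<alpha>$i > 0"
    and f_meas: "f \<in> borel_measurable lebesgue"
    and F_dens: "F = density lebesgue f"
    and F_prob: "prob_space F"
    and F_on_A: "emeasure F A = 1"
    and g_meas: "g \<in> borel_measurable lebesgue"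
    and G_dens: "G = density lebesgue g"
    and G_prob: "prob_space G"
    and G_on_Theta: "emeasure G (Theta U Bmin) = 1"
    and omega_pos: "\<omega> > 0"
    and omega_bound: "\<forall>w\<in>Theta_w U. \<forall>\<alpha>\<in>A. w \<bullet> \<alpha> \<le> \<omega>"
    and r_meas: "r \<in> borel_measurable lebesgue"
    and r_pos: "\<forall>\<alpha>\<in>A. r \<alpha> > 0"
  shows "\<exists>\<mu> :: (real^'d) \<times> real \<Rightarrow> real.
           \<mu> \<in> borel_measurable lebesgue \<and> (\<forall>\<theta>. \<mu> \<theta> \<ge> 0) \<and>
           (AE \<theta> in G. \<forall>t\<ge>0.
              qdual n G F r \<mu> (fst \<theta>) (snd \<theta>) (\<mu> \<theta>)
                \<le> qdual n G F r \<mu> (fst \<theta>) (snd \<theta>) t)"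
proof -
  \<comment> \<open>Testing the valuation bound at the centre of the box, with all weights
    \<open>U / 2\<close>, controls the sum of the coordinates of \<open>\<alpha>\<close>. This
    yields the norm bound and, at the cost of the factor 2, a bound on the closed box including its
    boundary.\<close>
  have A_bound: "norm \<alpha> \<le> 2 * \<omega> / U \<and> (\<forall>w\<in>cbox 0 (\<chi> i. U). 0 \<le> w \<bullet> \<alpha> \<and> w \<bullet> \<alpha> \<le> 2 * \<omega>)"
    if "\<alpha> \<in> A" for \<alpha>
  proof -
    have pos: "0 \<le> \<alpha> $ i" for i using A_pos that by (simp add: less_imp_le)
    have "(\<chi> i. U / 2) \<bullet> \<alpha> \<le> \<omega>"
      using omega_bound that U_pos by (auto simp: Theta_w_def)
    moreover have "(\<chi> i. U / 2) \<bullet> \<alpha> = U / 2 * (\<Sum>i\<in>UNIV. \<alpha> $ i)"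
      by (simp add: inner_vec_def sum_distrib_left)
    ultimately have sum: "U * (\<Sum>i\<in>UNIV. \<alpha> $ i) \<le> 2 * \<omega>" by simp
    have "norm \<alpha> \<le> (\<Sum>i\<in>UNIV. \<bar>\<alpha> $ i\<bar>)" by (rule norm_le_l1_cart)
    also have "\<dots> \<le> 2 * \<omega> / U"
      using sum pos U_pos by (simp add: field_simps)
    finally have "norm \<alpha> \<le> 2 * \<omega> / U" .
    moreover have "0 \<le> w \<bullet> \<alpha> \<and> w \<bullet> \<alpha> \<le> 2 * \<omega>" if "w \<in> cbox 0 (\<chi> i. U)" for w
    proof
      have w: "0 \<le> w $ i" "w $ i \<le> U" for i using that by (auto simp: mem_box_cart)
      show "0 \<le> w \<bullet> \<alpha>" by (auto simp: inner_vec_def intro!: sum_nonneg mult_nonneg_nonneg w pos)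
      have "w \<bullet> \<alpha> \<le> (\<Sum>i\<in>UNIV. U * \<alpha> $ i)"
        by (auto simp: inner_vec_def intro!: sum_mono mult_right_mono w pos)
      then show "w \<bullet> \<alpha> \<le> 2 * \<omega>" using sum by (simp add: sum_distrib_left)
    qed
    ultimately show ?thesis by blast
  qed
  interpret G: prob_space G by fact
  interpret F: prob_space F by fact
  have sets_G: "sets G = sets lebesgue" and sets_F: "sets F = sets lebesgue"
    using G_dens F_dens by simp_all
  have "AE \<alpha> in F. \<alpha> \<in> A"
    by (subst F.AE_in_set_eq_1) (use A_meas F_on_A sets_F in \<open>auto simp: F.emeasure_eq_measure\<close>)
  interpret market G F n r U "2 * \<omega> / U" "2 * \<omega>"
  proof
    show "sets G = sets lebesgue" "sets F = sets lebesgue" by fact+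
    show "r \<in> borel_measurable F" using r_meas by (simp add: measurable_cong_sets[OF sets_F refl])
    show "AE \<theta> in G. P \<theta>" if "AE \<theta> in lborel. P \<theta>" for P
    proof -
      have "AE \<theta> in lebesgue. P \<theta>" by (rule AE_completion[OF that])
      then show ?thesis
        unfolding G_dens AE_density[OF g_meas] by (auto elim!: eventually_mono)
    qed
    show "AE \<alpha> in F. 0 < r \<alpha> \<and> norm \<alpha> \<le> 2 * \<omega> / U \<and>
        (\<forall>w\<in>cbox 0 (\<chi> i. U). 0 \<le> w \<bullet> \<alpha> \<and> w \<bullet> \<alpha> \<le> 2 * \<omega>)"
      using \<open>AE \<alpha> in F. \<alpha> \<in> A\<close>
    proof eventually_elim
      case (elim \<alpha>)
      then show ?case using A_bound r_pos by blast
    qed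
  qed
  obtain \<mu> :: "(real^'d) \<times> real \<Rightarrow> real"
    where \<mu>: "\<mu> \<in> borel_measurable borel" "\<forall>\<theta>. 0 \<le> \<mu> \<theta>"
    and opt: "\<forall>w\<in>cbox 0 (\<chi> i. U). \<forall>B\<ge>Bmin. \<forall>t\<ge>0.
       qdual n G F r \<mu> w B (\<mu> (w, B)) \<le> qdual n G F r \<mu> w B t"
    using pacing_equilibrium_unbounded[of Bmin] U_pos omega_pos Bmin_pos by auto
  have "\<mu> \<in> borel_measurable lebesgue"
    using borel_imp_measurable(1)[OF \<mu>(1)] by (simp add: measurable_cong_sets[OF sets_G refl])
  moreover have "AE \<theta> in G. \<forall>t\<ge>0. qdual n G F r \<mu> (fst \<theta>) (snd \<theta>) (\<mu> \<theta>)
                \<le> qdual n G F r \<mu> (fst \<theta>) (snd \<theta>) t"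
  proof -
    \<comment> \<open>\<open>emeasure\<close> is 0 on non-measurable sets, so the value 1 already
      forces measurability.\<close>
    have "Theta U Bmin \<in> sets G"
      by (rule emeasure_neq_0_sets) (simp add: G_on_Theta)
    then have "AE \<theta> in G. \<theta> \<in> Theta U Bmin"
      by (subst G.AE_in_set_eq_1) (use G_on_Theta in \<open>auto simp: G.emeasure_eq_measure\<close>)
    then show ?thesis
    proof eventually_elim
      case (elim \<theta>)
      then have "fst \<theta> \<in> cbox 0 (\<chi> i. U)" "Bmin \<le> snd \<theta>"
        by (auto simp: Theta_def Theta_w_def mem_box_cart less_imp_le)
      then show ?case using opt[rule_format, of "fst \<theta>" "snd \<theta>"] by simp
    qed
  qed
  ultimately show ?thesis using \<mu>(2) by blast
qed

end
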